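(* Let $\mathcal{L} = \{l_1, l_2, \dots, l_s\}$ be a set of $s$ nonnegative integers with $0 \leq l_{1} < l_{2} < \cdots < l_{s}$. Suppose that $\mathcal{A} = \{A_1, A_2, \dots, A_{m}\}$ is a family of subsets of $[n]=\{1,\dots,n\}$ such that $|A_i\cap A_j|\in\mathcal{L}$ for every pair of distinct members $A_i, A_j$ of $\mathcal{A}$, and such that $|A_{i}| \notin \mathcal{L}$ for every $1 \leq i \leq m$. Let $k = \max_{1 \leq j \leq m} |A_{j}|$. If $n \geq \binom{k^{2}}{l_{1}+1}s + l_{1}$, then \[|\mathcal{A}|\leq \binom{n}{s}.\]
   Formalization: The formal theorem adds the hypothesis l_s < n (and s ≥ 1); without a bound on L the claim fails, e.g. n = 3, L = {0,2,3}, family {{1},{2},{3}}: k = 1 and the condition on n holds, but 3 > C(3,3) = 1. *)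

theory Defs
  imports Complex_Main
begin

end

theory Submission
  imports Defs "HOL-Library.Function_Algebras"
begin

text \<open>
  Write \<open>a\<close> and \<open>b\<close> for the least and the largest element of \<open>L\<close>. The Frankl--Wilson polynomial
  argument bounds an \<open>L\<close>-intersecting family with \<open>s\<close> intersection sizes by
  \<open>\<Sum>i\<le>s. n choose i\<close>; applied to the members containing a fixed \<open>(a+1)\<close>-set it loses
  one intersection size, and as \<open>n\<close> is large the resulting sum is barely more than its top term.

  If all members share an \<open>a\<close>-set \<open>X\<close>, either \<open>L\<close> is an interval and each member owns an
  \<open>s\<close>-subset outside \<open>X\<close>, or \<open>b \<ge> a + s\<close>: then members larger than \<open>b\<close> have at least \<open>s + 1\<close>
  points outside \<open>X\<close> and double counting of points bounds them by about \<open>s / (s + 1)\<close> of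
  \<open>(n - a) choose s\<close>, while members smaller than \<open>b\<close> use only \<open>s - 1\<close> intersection sizes and
  are negligible. Otherwise a union \<open>M\<close> of at most three members meets every member in more than \<open>a\<close>
  points and has fewer than \<open>k\<^sup>2\<close> points, so the \<open>(a+1)\<close>-subsets of \<open>M\<close> cover the family.
\<close>

section \<open>The Frankl--Wilson bound\<close>

interpretation fun_space: vector_space "\<lambda>(c::real) (f :: 'a \<Rightarrow> real) x. c * f x"
  by unfold_locales (auto simp: fun_eq_iff algebra_simps)

text \<open>The monomial whose variables are indexed by \<open>I\<close>, evaluated at the 0/1
  vector of \<open>B\<close>. Powers of a variable collapse on such vectors, so multilinear
  monomials suffice.\<close>

definition subset_monomial :: "'a set \<Rightarrow> 'a set \<Rightarrow> real" where
  "subset_monomial I B = of_bool (I \<subseteq> B)"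

definition monomials_upto :: "'a set \<Rightarrow> nat \<Rightarrow> ('a set \<Rightarrow> real) set" where
  "monomials_upto V d = subset_monomial ` {I. I \<subseteq> V \<and> card I \<le> d}"

lemma sum_apply: "(\<Sum>i\<in>I. f i) x = (\<Sum>i\<in>I. f i x :: real)"
  by (induction I rule: infinite_finite_induct) auto

lemma card_subsets_upto:
  assumes "finite V"
  shows "card {I. I \<subseteq> V \<and> card I \<le> d} = (\<Sum>i\<le>d. card V choose i)"
proof -
  have "{I. I \<subseteq> V \<and> card I \<le> d} = (\<Union>i\<le>d. {I. I \<subseteq> V \<and> card I = i})" by auto
  also have "card \<dots> = (\<Sum>i\<le>d. card {I. I \<subseteq> V \<and> card I = i})"
    by (rule card_UN_disjoint) (use assms in auto)
  finally show ?thesis using assms by (simp add: n_subsets)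
qed

lemma card_monomials_upto:
  assumes "finite V"
  shows "finite (monomials_upto V d)"
    and "card (monomials_upto V d) \<le> (\<Sum>i\<le>d. card V choose i)"
proof -
  have fin: "finite {I. I \<subseteq> V \<and> card I \<le> d}" using assms by auto
  then show "finite (monomials_upto V d)" unfolding monomials_upto_def by simp
  show "card (monomials_upto V d) \<le> (\<Sum>i\<le>d. card V choose i)"
    unfolding monomials_upto_def
    using card_image_le[OF fin] card_subsets_upto[OF assms] by metis
qed

text \<open>On 0/1 vectors \<open>card (A \<inter> B)\<close> is the sum of the variables in
  \<open>A\<close>, and multiplying by the variable of \<open>a\<close> only inserts
  \<open>a\<close> into the index set.\<close>

lemma subset_monomial_mult_card:
  assumes "finite A"
  shows "of_nat (card (A \<inter> B)) * subset_monomial I B = (\<Sum>a\<in>A. subset_monomial (insert a I) B)"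
proof -
  have "(\<Sum>a\<in>A. subset_monomial (insert a I) B)
      = (\<Sum>a\<in>A. (if a \<in> B then subset_monomial I B else 0))"
    by (rule sum.cong) (auto simp: subset_monomial_def)
  also have "\<dots> = (\<Sum>a\<in>A \<inter> B. subset_monomial I B)"
    by (rule sum.inter_restrict[OF assms, symmetric])
  finally show ?thesis by simp
qed

text \<open>By linearity one monomial suffices; there the linear factor inserts single points into
  \<open>I\<close>, so the degree bound grows by one.\<close>

lemma span_mult_linear_factor:
  fixes f :: "'a set \<Rightarrow> real"
  assumes V: "finite V" and A: "A \<subseteq> V"
    and f: "f \<in> fun_space.span (monomials_upto V d)"
  shows "(\<lambda>B. (real (card (A \<inter> B)) - c) * f B) \<in> fun_space.span (monomials_upto V (Suc d))"
  using f
proof (induction rule: fun_space.span_induct_alt)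
  case base
  have "(\<lambda>B. (real (card (A \<inter> B)) - c) * (0 :: 'a set \<Rightarrow> real) B) = 0"
    by (simp add: fun_eq_iff)
  then show ?case by (simp only: fun_space.span_zero)
next
  case (step r g h)
  then obtain I where I: "g = subset_monomial I" "I \<subseteq> V" "card I \<le> d"
    by (auto simp: monomials_upto_def)
  have finA: "finite A" using V A finite_subset by blast
  have mon: "subset_monomial J \<in> fun_space.span (monomials_upto V (Suc d))"
    if "J \<subseteq> V" "card J \<le> Suc d" for J
    using that by (intro fun_space.span_base) (auto simp: monomials_upto_def)
  have "subset_monomial (insert a I) \<in> fun_space.span (monomials_upto V (Suc d))" if "a \<in> A" for a
    by (rule mon) (use that A I V card_insert_le_m1[of "Suc d" I a] in auto)
  then have "(\<Sum>a\<in>A. subset_monomial (insert a I)) \<in> fun_space.span (monomials_upto V (Suc d))"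
    by (rule fun_space.span_sum)
  moreover have "subset_monomial I \<in> fun_space.span (monomials_upto V (Suc d))"
    using I by (intro mon) auto
  ultimately have "(\<lambda>B. r * ((\<Sum>a\<in>A. subset_monomial (insert a I)) - (\<lambda>B. c * subset_monomial I B)) B)
      + (\<lambda>B. (real (card (A \<inter> B)) - c) * h B) \<in> fun_space.span (monomials_upto V (Suc d))"
    using step by (intro fun_space.span_add fun_space.span_diff fun_space.span_scale)
  moreover have "(\<lambda>B. r * ((\<Sum>a\<in>A. subset_monomial (insert a I)) - (\<lambda>B. c * subset_monomial I B)) B)
      + (\<lambda>B. (real (card (A \<inter> B)) - c) * h B)
      = (\<lambda>B. (real (card (A \<inter> B)) - c) * ((\<lambda>x. r * g x) + h) B)"
    using subset_monomial_mult_card[OF finA, of _ I]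
    by (auto simp: fun_eq_iff I(1) algebra_simps sum_apply)
  ultimately show ?case by simp
qed

lemma prod_card_inter_in_span:
  assumes "finite V" "A \<subseteq> V" "finite L"
  shows "(\<lambda>B. \<Prod>l\<in>L. (real (card (A \<inter> B)) - real l))
    \<in> fun_space.span (monomials_upto V (card L))"
  using assms(3)
proof (induction rule: finite_induct)
  case empty
  have "(\<lambda>B. 1) = (subset_monomial {} :: 'a set \<Rightarrow> real)"
    by (simp add: fun_eq_iff subset_monomial_def)
  then show ?case
    by (auto intro!: fun_space.span_base simp: monomials_upto_def)
next
  case (insert l L)
  then show ?case
    using span_mult_linear_factor[OF assms(1,2) insert.IH, of "real l"] by simp
qed

text \<open>Each \<open>p A\<close> vanishes at every other member but not at \<open>A\<close>, so
  the \<open>p A\<close> are linearly independent. They lie in the span of the monomials of degree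
  at most \<open>card L\<close>, whose number is bounded by the right-hand side.\<close>

theorem card_L_intersecting_family_le:
  fixes V :: "'a set"
  assumes V: "finite V" and F: "\<And>A. A \<in> F \<Longrightarrow> A \<subseteq> V" and L: "finite L"
    and inter: "\<And>A B. A \<in> F \<Longrightarrow> B \<in> F \<Longrightarrow> A \<noteq> B \<Longrightarrow> card (A \<inter> B) \<in> L"
    and sizes: "\<And>A. A \<in> F \<Longrightarrow> card A \<notin> L"
  shows "card F \<le> (\<Sum>i\<le>card L. card V choose i)"
proof -
  define p where "p A = (\<lambda>B. \<Prod>l\<in>L. (real (card (A \<inter> B)) - real l))" for A :: "'a set"
  have finF: "finite F" by (rule finite_subset[of _ "Pow V"]) (use F V in auto)
  have p0: "p A B = 0" if "A \<in> F" "B \<in> F" "A \<noteq> B" for A B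
    using inter[OF that] L unfolding p_def by (auto intro!: prod_zero)
  have p1: "p A A \<noteq> 0" if "A \<in> F" for A
    using sizes[OF that] L unfolding p_def by (auto simp: prod_zero_iff)
  have inj: "inj_on p F"
    by (rule inj_onI) (metis p0 p1)
  have "fun_space.independent (p ` F)"
  proof (rule fun_space.independent_if_scalars_zero)
    show "finite (p ` F)" using finF by simp
    fix u f
    assume z: "(\<Sum>x\<in>p ` F. (\<lambda>y. u x * x y)) = 0" and "f \<in> p ` F"
    then obtain A where A: "A \<in> F" "f = p A" by auto
    \<comment> \<open>Evaluating the linear relation at \<open>A\<close> kills every term except
      that of \<open>A\<close>.\<close>
    have "0 = (\<Sum>x\<in>p ` F. (\<lambda>y. u x * x y)) A" using z by simp
    also have "\<dots> = (\<Sum>B\<in>F. u (p B) * p B A)"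
      by (simp add: sum_apply sum.reindex[OF inj])
    also have "\<dots> = (\<Sum>B\<in>F. if B = A then u (p A) * p A A else 0)"
      by (rule sum.cong) (use p0 A in auto)
    also have "\<dots> = u (p A) * p A A" using A finF by simp
    finally show "u f = 0" using p1 A by simp
  qed
  moreover have "p ` F \<subseteq> fun_space.span (monomials_upto V (card L))"
    using prod_card_inter_in_span[OF V F L] unfolding p_def by auto
  ultimately have "card (p ` F) \<le> card (monomials_upto V (card L))"
    using fun_space.independent_span_bound card_monomials_upto(1)[OF V] by blast
  then show ?thesis
    using card_image[OF inj] card_monomials_upto(2)[OF V, of "card L"] by simp
qed

text \<open>Deleting \<open>T\<close> is injective on \<open>F\<close> and lowers all sizes and
  intersection sizes by \<open>card T\<close>, so the Frankl--Wilson bound applies inside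
  \<open>V - T\<close>. \<open>L_ge\<close> keeps the truncated subtraction injective on
  \<open>L\<close>.\<close>

lemma card_L_intersecting_family_containing_le:
  fixes V :: "'a set"
  assumes V: "finite V" and F: "\<And>A. A \<in> F \<Longrightarrow> A \<subseteq> V" and L: "finite L"
    and inter: "\<And>A B. A \<in> F \<Longrightarrow> B \<in> F \<Longrightarrow> A \<noteq> B \<Longrightarrow> card (A \<inter> B) \<in> L"
    and sizes: "\<And>A. A \<in> F \<Longrightarrow> card A \<notin> L"
    and T: "T \<subseteq> V" "\<And>A. A \<in> F \<Longrightarrow> T \<subseteq> A"
    and L_ge: "\<And>l. l \<in> L \<Longrightarrow> card T \<le> l"
  shows "card F \<le> (\<Sum>i\<le>card L. (card V - card T) choose i)"
proof -
  have finT: "finite T" using V T(1) finite_subset by blast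
  have finA: "finite A" if "A \<in> F" for A using V F[OF that] finite_subset by blast
  have inj: "inj_on (\<lambda>A. A - T) F"
    by (rule inj_onI) (use T(2) in blast)
  have injL: "inj_on (\<lambda>l. l - card T) L"
    by (rule inj_on_diff_nat) (use L_ge in auto)
  have "card ((\<lambda>A. A - T) ` F)
      \<le> (\<Sum>i\<le>card ((\<lambda>l. l - card T) ` L). card (V - T) choose i)"
  proof (rule card_L_intersecting_family_le)
    show "finite (V - T)" "finite ((\<lambda>l. l - card T) ` L)" using V L by auto
    show "C \<subseteq> V - T" if "C \<in> (\<lambda>A. A - T) ` F" for C using that F by blast
  next
    fix C D assume "C \<in> (\<lambda>A. A - T) ` F" "D \<in> (\<lambda>A. A - T) ` F" "C \<noteq> D"
    then obtain A B where AB: "A \<in> F" "B \<in> F" "A \<noteq> B" "C = A - T" "D = B - T" by blast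
    have "C \<inter> D = A \<inter> B - T" using AB by blast
    then have "card (C \<inter> D) = card (A \<inter> B) - card T"
      using finT T(2) AB by (simp add: card_Diff_subset)
    then show "card (C \<inter> D) \<in> (\<lambda>l. l - card T) ` L" using inter AB by auto
  next
    fix C assume "C \<in> (\<lambda>A. A - T) ` F"
    then obtain A where A: "A \<in> F" "C = A - T" by blast
    have "card C = card A - card T" "card T \<le> card A"
      using A finT T(2) finA by (auto simp: card_Diff_subset card_mono)
    then show "card C \<notin> (\<lambda>l. l - card T) ` L"
      using sizes[OF A(1)] L_ge by (auto simp: eq_diff_iff)
  qed
  then show ?thesis
    using T(1) finT by (simp add: card_image inj injL card_Diff_subset)
qed

section \<open>Binomial estimates\<close>

text \<open>The quotient of consecutive binomials is \<open>(N - i) / Suc i\<close>, which the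
  assumption makes at least \<open>Suc m\<close>.\<close>

lemma binomial_step_ge:
  assumes "Suc m * Suc i + i \<le> N"
  shows "Suc m * (N choose i) \<le> N choose Suc i"
proof -
  have "Suc i * (Suc m * (N choose i)) = (Suc m * Suc i) * (N choose i)" by (simp only: ac_simps)
  also have "\<dots> \<le> (N - i) * (N choose i)" using assms by (intro mult_right_mono) linarith+
  also have "\<dots> = Suc i * (N choose Suc i)"
    using binomial_absorb_comp[of N i] binomial_absorption[of i N] by simp
  finally show ?thesis using mult_le_cancel1 by blast
qed

text \<open>Each binomial is at least \<open>Suc m\<close> times its predecessor, so for positive
  \<open>m\<close> a geometric series bounds the sum by \<open>Suc m / m\<close> times its top
  term.\<close>

lemma binomial_partial_sum_le:
  assumes "Suc (Suc m) * Suc i \<le> Suc N"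
  shows "m * (\<Sum>j\<le>i. N choose j) \<le> Suc m * (N choose i)"
  using assms
proof (induction i)
  case 0
  then show ?case by simp
next
  case (Suc i)
  have "Suc m * Suc i + i \<le> N" using Suc.prems by (simp add: algebra_simps)
  then have "Suc m * (N choose i) \<le> N choose Suc i" by (rule binomial_step_ge)
  moreover have "m * (\<Sum>j\<le>i. N choose j) \<le> Suc m * (N choose i)"
    using Suc by (simp add: algebra_simps)
  ultimately show ?case by (simp add: algebra_simps)
qed

lemma le_binomial:
  assumes "1 \<le> j" "j < N"
  shows "N \<le> N choose j"
  using assms
proof (induction N arbitrary: j)
  case 0
  then show ?case by simp
next
  case (Suc N)
  obtain i where i: "j = Suc i" using Suc.prems by (cases j) auto
  show ?case
  proof (cases "j = N")
    case True
    then show ?thesis by simp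
  next
    case False
    then have "N \<le> N choose j" using Suc by auto
    moreover have "1 \<le> N choose i"
      using Suc.prems i by (simp add: Suc_le_eq zero_less_binomial_iff)
    ultimately show ?thesis by (simp add: i)
  qed
qed

section \<open>Families with a common \<open>a\<close>-set\<close>

text \<open>Two members choosing the same \<open>s\<close>-subset outside \<open>X\<close> would
  share it together with \<open>X\<close>, hence meet in at least \<open>card X + s\<close>
  points.\<close>

lemma card_le_binomial_if_small_intersections:
  assumes V: "finite V" and F: "\<And>A. A \<in> F \<Longrightarrow> A \<subseteq> V"
    and inter: "\<And>A B. A \<in> F \<Longrightarrow> B \<in> F \<Longrightarrow> A \<noteq> B \<Longrightarrow> card (A \<inter> B) < card X + s"
    and sizes: "\<And>A. A \<in> F \<Longrightarrow> card X + s \<le> card A"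
    and X: "X \<subseteq> V" "\<And>A. A \<in> F \<Longrightarrow> X \<subseteq> A"
  shows "card F \<le> (card V - card X) choose s"
proof -
  have finX: "finite X" using V X(1) finite_subset by blast
  have finA: "finite A" if "A \<in> F" for A using V F[OF that] finite_subset by blast
  have "\<exists>S. S \<subseteq> A - X \<and> card S = s" if "A \<in> F" for A
  proof -
    have "s \<le> card (A - X)"
      using sizes[OF that] card_Diff_subset[OF finX X(2)[OF that]] by linarith
    then show ?thesis using obtain_subset_with_card_n by metis
  qed
  then obtain g where g: "\<And>A. A \<in> F \<Longrightarrow> g A \<subseteq> A - X \<and> card (g A) = s" by metis
  have "inj_on g F"
  proof (rule inj_onI, rule ccontr)
    fix A B assume AB: "A \<in> F" "B \<in> F" "g A = g B" "A \<noteq> B"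
    have "X \<union> g A \<subseteq> A \<inter> B" using X(2) g[of A] g[of B] AB by blast
    then have "card (X \<union> g A) \<le> card (A \<inter> B)"
      using finA AB by (intro card_mono) auto
    moreover have "card (X \<union> g A) = card X + s"
      using g[of A] AB finX finA[of A] finite_subset[of "g A" A]
      by (subst card_Un_disjoint) auto
    ultimately show False using inter[of A B] AB by linarith
  qed
  then have "card F = card (g ` F)" by (simp add: card_image)
  also have "\<dots> \<le> card {S. S \<subseteq> V - X \<and> card S = s}"
    by (rule card_mono) (use V g F in \<open>auto, blast\<close>)
  also have "\<dots> = (card V - card X) choose s"
    using V X(1) finX by (simp add: n_subsets card_Diff_subset)
  finally show ?thesis .
qed

lemma sum_card_Diff_eq:
  assumes "finite V" and "finite F" and F: "\<And>A. A \<in> F \<Longrightarrow> A \<subseteq> V"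
  shows "(\<Sum>A\<in>F. card (A - X)) = (\<Sum>x\<in>V - X. card {A \<in> F. x \<in> A})"
proof -
  have "(\<Sum>A\<in>F. card (A - X)) = (\<Sum>A\<in>F. \<Sum>x\<in>V - X. of_bool (x \<in> A))"
  proof (rule sum.cong[OF refl])
    fix A assume "A \<in> F"
    then have "A - X = (V - X) \<inter> A" using F by blast
    then show "card (A - X) = (\<Sum>x\<in>V - X. of_bool (x \<in> A))"
      using assms(1) by (simp add: Int_def)
  qed
  also have "\<dots> = (\<Sum>x\<in>V - X. \<Sum>A\<in>F. of_bool (x \<in> A))" by (rule sum.swap)
  also have "\<dots> = (\<Sum>x\<in>V - X. card {A \<in> F. x \<in> A})"
    using assms(2) by (simp add: Int_def)
  finally show ?thesis .
qed

lemma card_le_binomial_if_common_subset: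
  fixes V :: "'a set"
  assumes V: "finite V" and F: "\<And>A. A \<in> F \<Longrightarrow> A \<subseteq> V"
    and L: "finite L" "card L = s" "L \<subseteq> {a..b}" "a \<in> L" "b \<in> L"
    and inter: "\<And>A B. A \<in> F \<Longrightarrow> B \<in> F \<Longrightarrow> A \<noteq> B \<Longrightarrow> card (A \<inter> B) \<in> L"
    and sizes: "\<And>A. A \<in> F \<Longrightarrow> card A \<notin> L" "\<And>A. A \<in> F \<Longrightarrow> a < card A"
      "\<And>A. A \<in> F \<Longrightarrow> card A \<le> k"
    and k: "2 \<le> k"
    and n: "k\<^sup>2 * s + a \<le> card V"
    and X: "X \<subseteq> V" "card X = a" "\<And>A. A \<in> F \<Longrightarrow> X \<subseteq> A"
  shows "card F \<le> (card V - a) choose s"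
proof (cases "b < a + s")
  case True
  \<comment> \<open>\<open>L\<close> has \<open>s\<close> elements in an interval of at most
    \<open>s\<close> integers, so it fills it; sizes above \<open>a\<close> and outside
    \<open>L\<close> are then at least \<open>a + s\<close>.\<close>
  have "L = {a..<a + s}"
    by (rule card_subset_eq) (use L True in auto)
  then show ?thesis
    using card_le_binomial_if_small_intersections[OF V F, of F X s] inter sizes X
    by (metis (no_types, lifting) atLeastLessThan_iff less_imp_le_nat not_le_imp_less)
next
  case False
  have s: "2 \<le> s"
  proof -
    have "a \<noteq> b" using False L card_gt_0_iff[of L] by auto
    then have "card {a, b} = 2" by simp
    then show ?thesis using card_mono[of L "{a, b}"] L by simp
  qed
  define N where "N = card V - a"
  \<comment> \<open>With this \<open>m\<close> the bound on \<open>card V\<close> reads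
    \<open>Suc (Suc m) * s \<le> N\<close>, which is what \<open>binomial_partial_sum_le\<close>
    needs at top index \<open>s - 1\<close>, even over \<open>N - 1\<close> points.\<close>
  define m where "m = k\<^sup>2 - 2"
  have k4: "4 \<le> k\<^sup>2" using power_mono[of 2 k 2] k by simp
  then have km: "k\<^sup>2 = Suc (Suc m)" unfolding m_def by linarith
  obtain t where t: "s = Suc t" using s by (cases s) auto
  have N: "Suc (Suc m) * s \<le> N" using n km unfolding N_def by simp
  obtain N' where N': "N = Suc N'" using N s by (cases N) auto
  have finF: "finite F" by (rule finite_subset[of _ "Pow V"]) (use F V in auto)
  have finX: "finite X" using V X(1) finite_subset by blast
  define C where "C = N choose s"
  define small where "small = {A \<in> F. card A < b}"
  define big where "big = {A \<in> F. b < card A}"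
  have F_split: "card F = card small + card big"
  proof -
    have "F = small \<union> big" using sizes(1) L(5) unfolding small_def big_def
      by (auto, metis linorder_neqE_nat)
    moreover have "small \<inter> big = {}" unfolding small_def big_def by auto
    ultimately show ?thesis using finF card_Un_disjoint[of small big] by auto
  qed
  have "Suc m * (N choose t) \<le> C"
    unfolding C_def t using N by (intro binomial_step_ge) (simp add: t algebra_simps)
  moreover have "card small \<le> (\<Sum>i\<le>t. N choose i)"
  proof -
    \<comment> \<open>Distinct members below size \<open>b\<close> cannot meet in \<open>b\<close>
      points, so only \<open>s - 1\<close> intersection sizes remain.\<close>
    have "card small \<le> (\<Sum>i\<le>card (L - {b}). (card V - card X) choose i)"
    proof (rule card_L_intersecting_family_containing_le[OF V _ _ _ _ X(1)])
      fix A B assume AB: "A \<in> small" "B \<in> small" "A \<noteq> B"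
      then have "card (A \<inter> B) \<le> card A"
        using F V finite_subset[of A V] by (intro card_mono) (auto simp: small_def)
      then show "card (A \<inter> B) \<in> L - {b}" using AB inter by (auto simp: small_def)
    qed (use F L X sizes in \<open>auto simp: small_def\<close>)
    then show ?thesis using L t X unfolding N_def by simp
  qed
  moreover have "m * (\<Sum>i\<le>t. N choose i) \<le> Suc m * (N choose t)"
    using N by (intro binomial_partial_sum_le) (simp add: t)
  ultimately have small: "m * card small \<le> C"
    by (meson le_trans mult_le_mono2)
  show ?thesis
  proof (cases "big = {}")
    case True
    have "1 \<le> m" using k4 unfolding m_def by linarith
    then have "card small \<le> m * card small" by simp
    then have "card small \<le> C" using small by linarith
    then show ?thesis using True F_split by (simp add: C_def N_def)
  next
    case False
    \<comment> \<open>A big member has more than \<open>b \<ge> a + s\<close> points. Hence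
      \<open>k > s\<close>, and \<open>m = k\<^sup>2 - 2\<close> is large enough for the final
      comparison.\<close>
    have "Suc s \<le> k"
    proof -
      obtain A where "A \<in> big" using False by blast
      then show ?thesis using sizes(3)[of A] \<open>\<not> b < a + s\<close> unfolding big_def by auto
    qed
    then have "(Suc s)\<^sup>2 \<le> k\<^sup>2" by (intro power_mono) auto
    then have "s * s + 2 * s + 1 \<le> Suc (Suc m)" unfolding km by (simp add: power2_eq_square)
    moreover have "2 * s \<le> s * s" using s by simp
    ultimately have m: "2 * s + 1 \<le> m"
      using s by linarith
    \<comment> \<open>Members through \<open>x\<close> share the \<open>a + 1\<close> points of
      \<open>insert x X\<close>, so the intersection size \<open>a\<close> cannot occur among
      them.\<close>
    have point: "card {A \<in> big. x \<in> A} \<le> (\<Sum>i\<le>t. N' choose i)" if x: "x \<in> V - X" for x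
    proof -
      have card_ins: "card (insert x X) = Suc a" using x finX X by simp
      have "card {A \<in> big. x \<in> A}
        \<le> (\<Sum>i\<le>card (L - {a}). (card V - card (insert x X)) choose i)"
      proof (rule card_L_intersecting_family_containing_le[OF V])
        fix A B assume AB: "A \<in> {A \<in> big. x \<in> A}" "B \<in> {A \<in> big. x \<in> A}" "A \<noteq> B"
        then have "card (insert x X) \<le> card (A \<inter> B)"
          using F V X finite_subset[of A V] by (intro card_mono) (auto simp: big_def)
        then show "card (A \<inter> B) \<in> L - {a}"
          using AB inter card_ins by (auto simp: big_def)
      next
        fix l assume "l \<in> L - {a}"
        then have "a \<le> l" "l \<noteq> a" using L(3) by auto
        then show "card (insert x X) \<le> l" using card_ins by simp
      qed (use x F L X sizes in \<open>auto simp: big_def\<close>)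
      moreover have "card V - card (insert x X) = N'"
        using N' card_ins unfolding N_def by simp
      ultimately show ?thesis using L t by simp
    qed
    have "Suc s * card big = (\<Sum>A\<in>big. Suc s)" by simp
    also have "\<dots> \<le> (\<Sum>A\<in>big. card (A - X))"
    proof (rule sum_mono)
      fix A assume "A \<in> big"
      then have "card (A - X) = card A - a" "b < card A"
        using X finX by (auto simp: card_Diff_subset big_def)
      then show "Suc s \<le> card (A - X)" using \<open>\<not> b < a + s\<close> by linarith
    qed
    also have "\<dots> = (\<Sum>x\<in>V - X. card {A \<in> big. x \<in> A})"
      by (rule sum_card_Diff_eq) (use V finF F in \<open>auto simp: big_def\<close>)
    also have "\<dots> \<le> (\<Sum>x\<in>V - X. \<Sum>i\<le>t. N' choose i)"
      by (rule sum_mono) (rule point)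
    also have "\<dots> = N * (\<Sum>i\<le>t. N' choose i)"
      using X finX by (simp add: card_Diff_subset N_def)
    finally have "m * (Suc s * card big) \<le> N * (m * (\<Sum>i\<le>t. N' choose i))"
      by (metis mult.left_commute mult_le_mono2)
    also have "\<dots> \<le> N * (Suc m * (N' choose t))"
      using N N' by (intro mult_left_mono binomial_partial_sum_le) (auto simp: t)
    also have "\<dots> = Suc m * (s * C)"
      using Suc_times_binomial_eq[of N' t] unfolding C_def N' t by (simp add: algebra_simps)
    finally have big: "m * (Suc s * card big) \<le> Suc m * (s * C)" .
    \<comment> \<open>The total is \<open>(m * s + 2 * s + 1) * C\<close>, and
      \<open>2 * s + 1 \<le> m\<close> is exactly what brings it below
      \<open>m * Suc s * C\<close>.\<close>
    have "(m * Suc s) * card F = Suc s * (m * card small) + m * (Suc s * card big)"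
      using F_split by (simp add: algebra_simps)
    also have "\<dots> \<le> Suc s * C + Suc m * (s * C)"
      using small big by (intro add_mono mult_left_mono) auto
    also have "\<dots> = (m * s + (2 * s + 1)) * C" by (simp add: algebra_simps)
    also have "\<dots> \<le> (m * Suc s) * C" using m by (intro mult_right_mono) auto
    finally have "card F \<le> C" using m by (simp del: mult_Suc_right)
    then show ?thesis by (simp add: C_def N_def)
  qed
qed

section \<open>Families without a common \<open>a\<close>-set\<close>

text \<open>If no two distinct members meet in exactly \<open>a\<close> points, any single member
  serves as \<open>M\<close>. Otherwise \<open>M\<close> is the union of two members
  \<open>A\<close>, \<open>B\<close> meeting in \<open>a\<close> points and a third,
  \<open>D\<close>, that does not contain \<open>A \<inter> B\<close>.\<close>

lemma transversal_if_no_common_subset: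
  fixes F :: "'a set set"
  assumes fin: "\<And>A. A \<in> F \<Longrightarrow> finite A" and ne: "F \<noteq> {}"
    and inter: "\<And>A B. A \<in> F \<Longrightarrow> B \<in> F \<Longrightarrow> A \<noteq> B \<Longrightarrow> a \<le> card (A \<inter> B)"
    and sizes: "\<And>A. A \<in> F \<Longrightarrow> a < card A" "\<And>A. A \<in> F \<Longrightarrow> card A \<le> k"
    and a: "1 \<le> a"
    and no_common: "\<And>X. card X = a \<Longrightarrow> \<exists>A\<in>F. \<not> X \<subseteq> A"
  obtains M where "M \<subseteq> \<Union>F" "finite M" "card M + 3 \<le> 3 * k"
    "\<And>A. A \<in> F \<Longrightarrow> a < card (A \<inter> M)"
proof (cases "\<exists>A\<in>F. \<exists>B\<in>F. A \<noteq> B \<and> card (A \<inter> B) = a")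
  case False
  obtain A where A: "A \<in> F" using ne by blast
  show ?thesis
  proof
    show "A \<subseteq> \<Union>F" "finite A" using A fin by auto
    show "card A + 3 \<le> 3 * k" using sizes[OF A] a by linarith
    show "a < card (B \<inter> A)" if "B \<in> F" for B
    proof (cases "A = B")
      case True
      then show ?thesis using sizes(1)[OF A] by simp
    next
      case False
      then have "card (B \<inter> A) \<noteq> a" "a \<le> card (B \<inter> A)"
        using \<open>\<not> (\<exists>A\<in>F. \<exists>B\<in>F. A \<noteq> B \<and> card (A \<inter> B) = a)\<close> A that inter by blast+
      then show ?thesis by linarith
    qed
  qed
next
  case True
  then obtain A B where AB: "A \<in> F" "B \<in> F" "A \<noteq> B" "card (A \<inter> B) = a" by blast
  obtain D where D: "D \<in> F" "\<not> A \<inter> B \<subseteq> D" using no_common AB(4) by blast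
  have finABD: "finite A" "finite B" "finite D" using fin AB D by auto
  \<comment> \<open>If \<open>E\<close> met the union in at most \<open>a\<close> points,
    \<open>E \<inter> A\<close> and \<open>E \<inter> B\<close> would both be this whole trace,
    hence lie in \<open>A \<inter> B\<close> and equal it by size. The free \<open>S\<close> allows
    both \<open>{}\<close>, for counting \<open>M\<close>, and \<open>D\<close>.\<close>
  have key: "a < card (E \<inter> (A \<union> B \<union> S))" if "E \<in> F" "\<not> A \<inter> B \<subseteq> E" for E S
  proof (rule ccontr)
    assume le: "\<not> a < card (E \<inter> (A \<union> B \<union> S))"
    have finE: "finite E" using fin that by auto
    have "E \<inter> P = E \<inter> (A \<union> B \<union> S)" if "P \<in> {A, B}" for P
    proof (rule card_seteq)
      show "card (E \<inter> (A \<union> B \<union> S)) \<le> card (E \<inter> P)"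
        using le inter[of E P] \<open>E \<in> F\<close> \<open>\<not> A \<inter> B \<subseteq> E\<close> that AB by fastforce
    qed (use that finE in auto)
    then have "E \<inter> A = E \<inter> B" by blast
    then have "E \<inter> A \<subseteq> A \<inter> B" by blast
    moreover have "card (A \<inter> B) \<le> card (E \<inter> A)"
      using inter[of E A] AB that by auto
    ultimately have "E \<inter> A = A \<inter> B" using finABD by (intro card_seteq) auto
    then show False using that by blast
  qed
  show ?thesis
  proof
    show "A \<union> B \<union> D \<subseteq> \<Union>F" "finite (A \<union> B \<union> D)" using AB D finABD by auto
    \<comment> \<open>The overlaps save \<open>a\<close> points and then at least
      \<open>a + 1\<close> more, in total at least 3 since \<open>1 \<le> a\<close>.\<close>
    have "card (A \<union> B) + a = card A + card B"
      using card_Un_Int[of A B] finABD AB by simp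
    moreover have "card (A \<union> B \<union> D) + card (D \<inter> (A \<union> B)) = card (A \<union> B) + card D"
      using card_Un_Int[of "A \<union> B" D] finABD by (simp add: Int_commute)
    moreover have "a < card (D \<inter> (A \<union> B))" using key[OF D, of "{}"] by simp
    ultimately show "card (A \<union> B \<union> D) + 3 \<le> 3 * k"
      using a sizes(2)[OF AB(1)] sizes(2)[OF AB(2)] sizes(2)[OF D(1)] by linarith
    show "a < card (E \<inter> (A \<union> B \<union> D))" if E: "E \<in> F" for E
    proof (cases "A \<inter> B \<subseteq> E")
      case False
      then show ?thesis using key E by blast
    next
      case True
      show ?thesis
      proof (rule ccontr)
        assume le: "\<not> a < card (E \<inter> (A \<union> B \<union> D))"
        have finE: "finite E" using fin E by auto
        have "E \<noteq> D" using True D by blast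
        then have "a \<le> card (E \<inter> D)" using inter E D by blast
        \<comment> \<open>The trace of \<open>E\<close> on \<open>M\<close> contains
          \<open>A \<inter> B\<close>; were it equal to \<open>E \<inter> D\<close>,
          \<open>D\<close> would contain \<open>A \<inter> B\<close>.\<close>
        then have "E \<inter> D = E \<inter> (A \<union> B \<union> D)"
          using le finE by (intro card_seteq) auto
        then show False using True D(2) by blast
      qed
    qed
  qed
qed

lemma card_le_binomial_if_no_common_subset:
  fixes V :: "'a set"
  assumes V: "finite V" and F: "\<And>A. A \<in> F \<Longrightarrow> A \<subseteq> V"
    and L: "finite L" "card L = s" "\<And>l. l \<in> L \<Longrightarrow> a \<le> l" "a \<in> L"
    and inter: "\<And>A B. A \<in> F \<Longrightarrow> B \<in> F \<Longrightarrow> A \<noteq> B \<Longrightarrow> card (A \<inter> B) \<in> L"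
    and sizes: "\<And>A. A \<in> F \<Longrightarrow> card A \<notin> L" "\<And>A. A \<in> F \<Longrightarrow> a < card A"
      "\<And>A. A \<in> F \<Longrightarrow> card A \<le> k"
    and a: "1 \<le> a" "a < k"
    and n: "(k\<^sup>2 choose (a + 1)) * s + a \<le> card V"
    and no_common: "\<And>X. card X = a \<Longrightarrow> \<exists>A\<in>F. \<not> X \<subseteq> A"
  shows "card F \<le> (card V - a) choose s"
proof (cases "F = {}")
  case True
  then show ?thesis by simp
next
  case False
  have finA: "finite A" if "A \<in> F" for A using V F[OF that] finite_subset by blast
  obtain M where M: "M \<subseteq> \<Union>F" "finite M" "card M + 3 \<le> 3 * k"
    "\<And>A. A \<in> F \<Longrightarrow> a < card (A \<inter> M)"
    using transversal_if_no_common_subset[OF finA False L(3)[OF inter] sizes(2,3) a(1) no_common]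
    by blast
  define K where "K = k\<^sup>2"
  define m where "m = K - 2"
  \<comment> \<open>This makes \<open>card M \<le> 3 * k - 3\<close> strictly smaller than
    \<open>k\<^sup>2\<close>; equality holds at \<open>k = 2\<close>.\<close>
  have "3 * k \<le> k * k + 2"
  proof (cases "k = 2")
    case False
    then have "3 * k \<le> k * k" using a by (intro mult_le_mono1) linarith
    then show ?thesis by linarith
  qed simp
  then have MK: "card M \<le> K - 1" using M(3) unfolding K_def power2_eq_square by linarith
  have k2: "2 \<le> k" using a by linarith
  have K4: "4 \<le> K" unfolding K_def using power_mono[of 2 k 2] k2 by simp
  then have km: "K = Suc (Suc m)" unfolding m_def by linarith
  obtain t where t: "s = Suc t" using L by (cases s) auto
  define N where "N = card V - a"
  have "k < K" unfolding K_def power2_eq_square using k2 by simp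
  then have KC: "K \<le> K choose (a + 1)"
    using a by (intro le_binomial) linarith+
  have nC: "(K choose (a + 1)) * s \<le> N" using n unfolding N_def K_def by linarith
  then have N: "K * s \<le> N" using KC by (meson le_trans mult_le_mono1)
  obtain N' where N': "N = Suc N'" using N K4 t by (cases N) auto
  \<comment> \<open>Members sharing \<open>a + 1\<close> points never meet in exactly
    \<open>a\<close>, so one intersection size drops out.\<close>
  have containing: "card {A \<in> F. T \<subseteq> A} \<le> (\<Sum>i\<le>t. N' choose i)"
    if T: "T \<subseteq> M" "card T = a + 1" for T
  proof -
    have "card {A \<in> F. T \<subseteq> A} \<le> (\<Sum>i\<le>card (L - {a}). (card V - card T) choose i)"
    proof (rule card_L_intersecting_family_containing_le[OF V])
      show "T \<subseteq> V" using T M(1) F by blast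
    next
      fix A B assume AB: "A \<in> {A \<in> F. T \<subseteq> A}" "B \<in> {A \<in> F. T \<subseteq> A}" "A \<noteq> B"
      then have "card T \<le> card (A \<inter> B)" using finA by (intro card_mono) auto
      then show "card (A \<inter> B) \<in> L - {a}" using AB inter T(2) by auto
    next
      fix l assume "l \<in> L - {a}"
      then show "card T \<le> l" using L(3)[of l] T(2) by simp
    qed (use F L sizes in auto)
    moreover have "card V - card T = N'" using N' T(2) unfolding N_def by simp
    ultimately show ?thesis using L t by simp
  qed
  define TT where "TT = {T. T \<subseteq> M \<and> card T = a + 1}"
  have finTT: "finite TT" and cardTT: "card TT = card M choose (a + 1)"
    unfolding TT_def using M(2) by (auto simp: n_subsets)
  have "F \<subseteq> (\<Union>T\<in>TT. {A \<in> F. T \<subseteq> A})"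
  proof
    fix A assume A: "A \<in> F"
    then have "a + 1 \<le> card (A \<inter> M)" using M(4) by fastforce
    then obtain T where "T \<subseteq> A \<inter> M" "card T = a + 1"
      using obtain_subset_with_card_n by metis
    then show "A \<in> (\<Union>T\<in>TT. {A \<in> F. T \<subseteq> A})" using A unfolding TT_def by blast
  qed
  moreover have finF: "finite F" by (rule finite_subset[of _ "Pow V"]) (use F V in auto)
  ultimately have "card F \<le> card (\<Union>T\<in>TT. {A \<in> F. T \<subseteq> A})"
    using finTT by (intro card_mono) auto
  also have "\<dots> \<le> (\<Sum>T\<in>TT. card {A \<in> F. T \<subseteq> A})" by (rule card_UN_le[OF finTT])
  also have "\<dots> \<le> (\<Sum>T\<in>TT. \<Sum>i\<le>t. N' choose i)"
    by (rule sum_mono) (use containing in \<open>auto simp: TT_def\<close>)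
  also have "\<dots> = (card M choose (a + 1)) * (\<Sum>i\<le>t. N' choose i)" by (simp add: cardTT)
  also have "\<dots> \<le> ((K - 1) choose (a + 1)) * (\<Sum>i\<le>t. N' choose i)"
    using MK by (intro mult_right_mono binomial_right_mono) auto
  finally have F_le: "card F \<le> ((K - 1) choose (a + 1)) * (\<Sum>i\<le>t. N' choose i)" .
  have sum_le: "m * (\<Sum>i\<le>t. N' choose i) \<le> Suc m * (N' choose t)"
    using N N' by (intro binomial_partial_sum_le) (simp add: t km)
  \<comment> \<open>The factor lost by \<open>card M \<le> K - 1\<close> pays for the lower-order binomials.\<close>
  have "K * ((K - 1) choose (a + 1)) = (K - (a + 1)) * (K choose (a + 1))"
    using binomial_absorb_comp[of K "a + 1"] by simp
  also have "\<dots> \<le> m * (K choose (a + 1))"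
    using a unfolding m_def by (intro mult_right_mono) auto
  finally have CK: "K * ((K - 1) choose (a + 1)) \<le> m * (K choose (a + 1))" .
  \<comment> \<open>The losses \<open>m / K\<close> and \<open>Suc m / m\<close> multiply to
    \<open>Suc m / K\<close>, which is below 1 because \<open>K = m + 2\<close>.\<close>
  have "K * (m * card F)
      \<le> (K * ((K - 1) choose (a + 1))) * (m * (\<Sum>i\<le>t. N' choose i))"
    using mult_le_mono2[OF F_le, of "K * m"] by (simp add: ac_simps)
  also have "\<dots> \<le> (m * (K choose (a + 1))) * (Suc m * (N' choose t))"
    by (rule mult_le_mono[OF CK sum_le])
  also have "\<dots> \<le> K * (m * ((K choose (a + 1)) * (N' choose t)))"
    using mult_le_mono1[of "Suc m" K "m * ((K choose (a + 1)) * (N' choose t))"]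
    by (simp add: km ac_simps del: mult_Suc mult_Suc_right)
  finally have "card F \<le> (K choose (a + 1)) * (N' choose t)"
    using K4 unfolding m_def by simp
  \<comment> \<open>Multiplying by \<open>s\<close> lets \<open>nC\<close> replace the number of
    covering sets by \<open>N\<close>, and absorption then gives \<open>N choose s\<close>.\<close>
  then have "s * card F \<le> ((K choose (a + 1)) * s) * (N' choose t)"
    using mult_le_mono2[of _ _ s] by (simp add: ac_simps)
  also have "\<dots> \<le> N * (N' choose t)" using nC by (rule mult_le_mono1)
  also have "\<dots> = s * (N choose s)"
    using Suc_times_binomial_eq[of N' t] unfolding N' t by (simp add: algebra_simps)
  finally show ?thesis using t by (simp add: N_def del: mult_Suc)
qed

section \<open>Degenerate families and the combination of the two cases\<close>

theorem theorem1p9: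
  fixes n s k :: nat
    and l :: "nat \<Rightarrow> nat"
    and L :: "nat set"
    and \<A> :: "nat set set"
  assumes "1 \<le> s"
    and "strict_mono_on {1..s} l"
    and "L = l ` {1..s}"
    and "l s < n"
    and "\<forall>A\<in>\<A>. A \<subseteq> {1..n}"
    and "\<forall>A\<in>\<A>. \<forall>B\<in>\<A>. A \<noteq> B \<longrightarrow> card (A \<inter> B) \<in> L"
    and "\<forall>A\<in>\<A>. card A \<notin> L"
    and "k = Max (card ` \<A>)"
    and "n \<ge> (k\<^sup>2 choose (l 1 + 1)) * s + l 1"
  shows "card \<A> \<le> n choose s"
proof -
  have finA: "finite \<A>"
    by (rule finite_subset[of _ "Pow {1..n}"]) (use assms(5) in auto)
  have finset: "finite A" if "A \<in> \<A>" for A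
    using assms(5) that finite_subset by blast
  have inj: "inj_on l {1..s}" using assms(2) by (rule strict_mono_on_imp_inj_on)
  have L: "finite L" "card L = s" "l 1 \<in> L" "l s \<in> L"
    using assms(1,3) card_image[OF inj] by auto
  have L_sub: "L \<subseteq> {l 1..l s}"
    using assms(1) strict_mono_on_leD[OF assms(2)] unfolding assms(3) by auto
  have L_sub_n: "L \<subseteq> {..<n}" using L_sub assms(4) by auto
  then have sn: "s \<le> n" using card_mono[of "{..<n}" L] L by simp
  show ?thesis
  proof (cases "card \<A> \<le> 1")
    case True
    moreover have "1 \<le> n choose s" using sn by (simp add: Suc_le_eq zero_less_binomial_iff)
    ultimately show ?thesis by linarith
  next
    case False
    \<comment> \<open>A second member forces every size to be at least \<open>l 1\<close>, and
      equality is excluded because \<open>l 1\<close> lies in \<open>L\<close>.\<close>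
    have size_gt: "l 1 < card A" if A: "A \<in> \<A>" for A
    proof -
      have "\<exists>B\<in>\<A>. A \<noteq> B"
      proof (rule ccontr)
        assume "\<not> (\<exists>B\<in>\<A>. A \<noteq> B)"
        then have "\<A> \<subseteq> {A}" by blast
        then show False using False card_mono[of "{A}" \<A>] by simp
      qed
      then obtain B where B: "B \<in> \<A>" "A \<noteq> B" by blast
      have "l 1 \<le> card (A \<inter> B)" using assms(6) A B L_sub by fastforce
      also have "\<dots> \<le> card A" using finset[OF A] by (intro card_mono) auto
      finally show ?thesis using assms(7) A L(3) by (metis le_neq_implies_less)
    qed
    have size_le: "card A \<le> k" if "A \<in> \<A>" for A
      using finA that by (simp add: assms(8))
    obtain A0 where A0: "A0 \<in> \<A>" using False by fastforce
    have lk: "l 1 < k" using size_gt[OF A0] size_le[OF A0] by linarith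
    have inter: "card (A \<inter> B) \<in> L" if "A \<in> \<A>" "B \<in> \<A>" "A \<noteq> B" for A B
      using assms(6) that by blast
    have sub: "A \<subseteq> {1..n}" if "A \<in> \<A>" for A using assms(5) that by blast
    have nin: "card A \<notin> L" if "A \<in> \<A>" for A using assms(7) that by blast
    show ?thesis
    proof (cases "k = 1")
      case True
      \<comment> \<open>Here \<open>l 1 = 0\<close>, the family consists of singletons, and
        \<open>n\<close> itself bounds it.\<close>
      have one: "card A = 1" if "A \<in> \<A>" for A
        using size_gt[OF that] size_le[OF that] True by linarith
      have "card \<A> \<le> card {S. S \<subseteq> {1..n} \<and> card S = 1}"
        by (rule card_mono) (use sub one in auto)
      then have An: "card \<A> \<le> n" by (simp add: n_subsets)
      show ?thesis
      proof (cases "s = n")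
        case True
        \<comment> \<open>When \<open>s = n\<close> the set \<open>L\<close> contains every number
          below \<open>n\<close>; as the size 1 is not in \<open>L\<close>, \<open>n\<close> is at
          most 1.\<close>
        then have "L = {..<n}" using card_subset_eq[OF _ L_sub_n] L by simp
        then have "n \<le> 1" using nin[OF A0] one[OF A0] by simp
        then show ?thesis using An True by simp
      next
        case False
        then show ?thesis using An le_binomial[of s n] sn assms(1) by linarith
      qed
    next
      case k1: False
      then have k2: "2 \<le> k" using lk by linarith
      have "card \<A> \<le> (card {1..n} - l 1) choose s"
      proof (cases "\<exists>X. card X = l 1 \<and> (\<forall>A\<in>\<A>. X \<subseteq> A)")
        case True
        then obtain X where X: "card X = l 1" "\<And>A. A \<in> \<A> \<Longrightarrow> X \<subseteq> A" by blast
        have XV: "X \<subseteq> {1..n}" using X(2)[OF A0] sub[OF A0] by blast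
        have "k * 2 \<le> k\<^sup>2" using k2 by (simp add: power2_eq_square)
        \<comment> \<open>As \<open>l 1 + 1 \<le> k < k\<^sup>2\<close>, the assumed bound on
          \<open>n\<close> implies the weaker one used with a common subset.\<close>
        then have "k\<^sup>2 \<le> k\<^sup>2 choose (l 1 + 1)"
          using lk k2 by (intro le_binomial) linarith+
        then have "k\<^sup>2 * s + l 1 \<le> card {1..n}"
          using assms(9) mult_le_mono1[of "k\<^sup>2" "k\<^sup>2 choose (l 1 + 1)" s]
          unfolding card_atLeastAtMost by linarith
        then show ?thesis
          using card_le_binomial_if_common_subset[OF _ sub L(1,2) L_sub L(3,4) inter nin
              size_gt size_le k2 _ XV X]
          by simp
      next
        case False
        \<comment> \<open>For \<open>l 1 = 0\<close> the empty set would be a common subset of the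
          right size.\<close>
        have "l 1 \<noteq> 0"
          using False by (metis card.empty empty_subsetI)
        then show ?thesis
          using card_le_binomial_if_no_common_subset[OF _ sub L(1,2) _ L(3) inter nin
              size_gt size_le _ lk]
            assms(9) False L_sub by (auto simp: subset_iff)
      qed
      also have "\<dots> \<le> n choose s" by (simp add: binomial_right_mono)
      finally show ?thesis .
    qed
  qed
qed

end
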